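(* Suppose $K$ users follow the proportional strategy, in which each user at each time slot independently senses channel $i$ with probability $\tau_i=\theta_i/\sum_{l=1}^N\theta_l$. For any $K$, the performance loss compared with the centralized scheme is $$L=BT\sum_{i=1}^N\theta_i(1-\tau_i)^K=BT\sum_{i=1}^N\theta_i\left(\frac{\sum_{l=1}^N\theta_l-\theta_i}{\sum_{l=1}^N\theta_l}\right)^K,$$ and $$\lim_{K\to\infty}\frac{L}{e^{-c_2K}}=BT\theta_{l^*},\qquad \theta_{l^*}=\min\{\theta_i:\theta_i>0\},\qquad c_2=\ln\frac{\sum_{l=1}^N\theta_l}{\sum_{l=1}^N\theta_l-\theta_{l^*}},$$ so the loss goes to zero exponentially as $K$ increases.
   Context: There are $N$ channels, $K$ users and $T$ time slots; $B$ is the number of bits that can be sent over a free channel in one slot. In each slot channel $i$ is free with probability $\theta_i$, independently over channels and slots and of the users' choices. In each slot each user senses one channel; if channel $i$ is free and at least one user senses it, exactly one of the users sensing it transmits $B$ bits; otherwise nothing is transmitted on channel $i$. The loss $L$ of a strategy compared with the centralized scheme is $BT\sum_{i=1}^N\theta_i$ (the average total spectral opportunity over $T$ slots) minus the expected total number of bits transmitted by all $K$ users over the $T$ slots.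
   Formalization: The limit is proved when at least two channels have positive θ (otherwise c_2 is undefined) and equals BTθ_{l*} if exactly one channel attains the minimum; if m channels tie (e.g. θ_1=θ_2=1/2), the stated value is false and the correct limit m·BTθ_{l*} is proved. *)

theory Defs
  imports "HOL-Probability.Probability"
begin

text \<open>
  Channels, users and slots are numbered \<open>{1..N}\<close>, \<open>{1..K}\<close>, \<open>{1..T}\<close>:
  \<open>avail i t\<close> means that channel \<open>i\<close> is free in slot \<open>t\<close>, \<open>sense k t\<close> is the channel sensed
  by user \<open>k\<close> in slot \<open>t\<close>, and \<open>tx k i t\<close> means that user \<open>k\<close> transmits on channel \<open>i\<close> in
  slot \<open>t\<close>.  How a contention is resolved is left open (it may be random): only the uniqueness of
  the transmitting user is required.  In \<open>avail_sense_indep\<close>, the availabilities are coded by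
  \<open>of_bool\<close> because \<open>indep_var\<close> wants both variables to have the same type.
\<close>

locale sensing_system = prob_space M
  for M :: "'w measure" +
  fixes N K T :: nat
    and \<theta> :: "nat \<Rightarrow> real"
    and avail :: "nat \<Rightarrow> nat \<Rightarrow> 'w \<Rightarrow> bool"
    and sense :: "nat \<Rightarrow> nat \<Rightarrow> 'w \<Rightarrow> nat"
    and tx :: "nat \<Rightarrow> nat \<Rightarrow> nat \<Rightarrow> 'w \<Rightarrow> bool"
  assumes avail_prob:
      "\<lbrakk>i \<in> {1..N}; t \<in> {1..T}\<rbrakk> \<Longrightarrow> prob {\<omega> \<in> space M. avail i t \<omega>} = \<theta> i"
    and avail_indep:
      "indep_vars (\<lambda>_. count_space UNIV) (\<lambda>(i, t). avail i t) ({1..N} \<times> {1..T})"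
    and sense_channel:
      "\<lbrakk>k \<in> {1..K}; t \<in> {1..T}; \<omega> \<in> space M\<rbrakk> \<Longrightarrow> sense k t \<omega> \<in> {1..N}"
    and avail_sense_indep:
      "indep_var
         (PiM ({1..N} \<times> {1..T}) (\<lambda>_. count_space UNIV))
         (\<lambda>\<omega>. \<lambda>(i, t) \<in> {1..N} \<times> {1..T}. (of_bool (avail i t \<omega>) :: nat))
         (PiM ({1..K} \<times> {1..T}) (\<lambda>_. count_space UNIV))
         (\<lambda>\<omega>. \<lambda>(k, t) \<in> {1..K} \<times> {1..T}. sense k t \<omega>)"
    and tx_measurable:
      "\<lbrakk>k \<in> {1..K}; i \<in> {1..N}; t \<in> {1..T}\<rbrakk> \<Longrightarrow> {\<omega> \<in> space M. tx k i t \<omega>} \<in> sets M"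
    and tx_only:
      "\<lbrakk>k \<in> {1..K}; i \<in> {1..N}; t \<in> {1..T}; \<omega> \<in> space M; tx k i t \<omega>\<rbrakk>
         \<Longrightarrow> avail i t \<omega> \<and> sense k t \<omega> = i"
    and tx_unique:
      "\<lbrakk>i \<in> {1..N}; t \<in> {1..T}; \<omega> \<in> space M; avail i t \<omega>; \<exists>k\<in>{1..K}. sense k t \<omega> = i\<rbrakk>
         \<Longrightarrow> \<exists>!k. k \<in> {1..K} \<and> tx k i t \<omega>"

definition sensing_prob :: "nat \<Rightarrow> (nat \<Rightarrow> real) \<Rightarrow> nat \<Rightarrow> real" where
  "sensing_prob N \<theta> i = \<theta> i / (\<Sum>l=1..N. \<theta> l)"

locale proportional_system = sensing_system +
  assumes sense_prob:
      "\<lbrakk>k \<in> {1..K}; t \<in> {1..T}; i \<in> {1..N}\<rbrakk>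
         \<Longrightarrow> prob {\<omega> \<in> space M. sense k t \<omega> = i} = sensing_prob N \<theta> i"
    and sense_indep:
      "indep_vars (\<lambda>_. count_space UNIV) (\<lambda>(k, t). sense k t) ({1..K} \<times> {1..T})"

definition user_bits ::
    "nat \<Rightarrow> nat \<Rightarrow> real \<Rightarrow> (nat \<Rightarrow> nat \<Rightarrow> nat \<Rightarrow> 'w \<Rightarrow> bool) \<Rightarrow> nat \<Rightarrow> 'w \<Rightarrow> real" where
  "user_bits N T B tx k \<omega> = (\<Sum>t=1..T. \<Sum>i=1..N. if tx k i t \<omega> then B else 0)"

definition loss ::
    "'w measure \<Rightarrow> nat \<Rightarrow> nat \<Rightarrow> nat \<Rightarrow> real \<Rightarrow> (nat \<Rightarrow> real) \<Rightarrow>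
     (nat \<Rightarrow> nat \<Rightarrow> nat \<Rightarrow> 'w \<Rightarrow> bool) \<Rightarrow> real" where
  "loss M N K T B \<theta> tx =
     B * real T * (\<Sum>i=1..N. \<theta> i)
     - integral\<^sup>L M (\<lambda>\<omega>. \<Sum>k=1..K. user_bits N T B tx k \<omega>)"

definition min_pos :: "nat \<Rightarrow> (nat \<Rightarrow> real) \<Rightarrow> real" where
  "min_pos N \<theta> = Min {\<theta> i | i. i \<in> {1..N} \<and> 0 < \<theta> i}"

text \<open>
  The argument of the logarithm has a zero denominator, so that the exponent is infinite, when
  exactly one channel has positive \<open>\<theta>\<close>.
\<close>

definition decay_exponent :: "nat \<Rightarrow> (nat \<Rightarrow> real) \<Rightarrow> real" where
  "decay_exponent N \<theta> =
     ln ((\<Sum>l=1..N. \<theta> l) / ((\<Sum>l=1..N. \<theta> l) - min_pos N \<theta>))"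

end

theory Submission
  imports Defs
begin

text \<open>In one slot a channel carries data exactly when it is free and sensed, so the expected
  loss on it is B times the probability that it is free but unsensed. Availability is independent of
  sensing and the users choose independently, so this probability is a product
  (\<open>prob_avail_unsensed\<close>); linearity of expectation over slots, channels and users then
  gives the exact loss (\<open>loss_eq\<close>).

  With S the sum of all \<theta> i, the loss is a combination of the geometric sequences ((S -
  \<theta> i) / S)^K with weights \<theta> i. Among channels of positive weight the slowest decay
  comes from the least \<theta> i, and when at least two weights are positive its ratio is
  exp(-\<open>c\<^sub>2\<close>). Dividing by this sequence leaves one constant for each channel
  attaining the minimum and null sequences elsewhere (\<open>normalized_loss_tendsto\<close>), so
  ties multiply the limit. With a single positive weight that ratio is 0, and a cruder geometric
  bound with positive ratio still yields exponential decay (\<open>loss_bigo_exp\<close>).\<close>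

context proportional_system
begin

section \<open>Exact loss for a fixed number of users\<close>

lemma avail_measurable:
  assumes "i \<in> {1..N}" "t \<in> {1..T}"
  shows "avail i t \<in> measurable M (count_space UNIV)"
  using avail_indep assms unfolding indep_vars_def2 by fastforce

lemma sense_measurable:
  assumes "k \<in> {1..K}" "t \<in> {1..T}"
  shows "sense k t \<in> measurable M (count_space UNIV)"
  using sense_indep assms unfolding indep_vars_def2 by fastforce

text \<open>The K users choose independently in slot t, and each misses channel i with the
  complementary probability.\<close>

lemma prob_unsensed:
  assumes i: "i \<in> {1..N}" and t: "t \<in> {1..T}"
  shows "prob {\<omega> \<in> space M. \<forall>k\<in>{1..K}. sense k t \<omega> \<noteq> i} = (1 - sensing_prob N \<theta> i) ^ K"
\<comment> \<open>The product rule for independent variables is stated for nonempty index sets; with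
  no users the event is the whole space.\<close>
proof (cases "K = 0")
  case True
  then show ?thesis by (simp add: prob_space)
next
  case False
  let ?J = "{1..K} \<times> {t}"
  have "prob (\<Inter>p\<in>?J. (case p of (k, t) \<Rightarrow> sense k t) -` (- {i}) \<inter> space M)
      = (\<Prod>p\<in>?J. prob ((case p of (k, t) \<Rightarrow> sense k t) -` (- {i}) \<inter> space M))"
    using False t by (intro indep_varsD[OF sense_indep]) auto
  also have "(\<Inter>p\<in>?J. (case p of (k, t) \<Rightarrow> sense k t) -` (- {i}) \<inter> space M)
      = {\<omega> \<in> space M. \<forall>k\<in>{1..K}. sense k t \<omega> \<noteq> i}"
    using False by fastforce
  also have "(\<Prod>p\<in>?J. prob ((case p of (k, t) \<Rightarrow> sense k t) -` (- {i}) \<inter> space M))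
      = (\<Prod>p\<in>?J. 1 - sensing_prob N \<theta> i)"
  proof (intro prod.cong refl)
    fix p assume "p \<in> ?J"
    then obtain k where p: "p = (k, t)" "k \<in> {1..K}" by auto
    have "{\<omega> \<in> space M. sense k t \<omega> = i} \<in> events"
      using measurable_sets[OF sense_measurable[OF p(2) t], of "{i}"]
      by (simp add: vimage_def Int_def conj_commute)
    then have "prob (space M - {\<omega> \<in> space M. sense k t \<omega> = i}) = 1 - sensing_prob N \<theta> i"
      using sense_prob[OF p(2) t i] by (simp add: prob_compl)
    also have "space M - {\<omega> \<in> space M. sense k t \<omega> = i} = sense k t -` (- {i}) \<inter> space M"
      by auto
    finally show "prob ((case p of (k, t) \<Rightarrow> sense k t) -` (- {i}) \<inter> space M)
        = 1 - sensing_prob N \<theta> i"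
      using p by simp
  qed
  also have "\<dots> = (1 - sensing_prob N \<theta> i) ^ K"
    by (simp add: card_cartesian_product)
  finally show ?thesis .
qed

text \<open>Being free depends only on the table of availabilities, being unsensed only on the table
  of sensing choices, and the two tables are independent.\<close>

lemma prob_avail_unsensed:
  assumes i: "i \<in> {1..N}" and t: "t \<in> {1..T}"
  shows "prob {\<omega> \<in> space M. avail i t \<omega> \<and> (\<forall>k\<in>{1..K}. sense k t \<omega> \<noteq> i)}
    = \<theta> i * (1 - sensing_prob N \<theta> i) ^ K"
proof -
  \<comment> \<open>\<open>?f\<close> and \<open>?h\<close> extract the two events from the tables
    as 0/1 values; both take values in \<open>nat\<close> because \<open>indep_var\<close> needs a
    common type. The events are then the preimages of 1.\<close>
  let ?f = "\<lambda>g :: nat \<times> nat \<Rightarrow> nat. g (i, t)"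
  let ?h = "\<lambda>g :: nat \<times> nat \<Rightarrow> nat. of_bool (\<forall>k\<in>{1..K}. g (k, t) \<noteq> i) :: nat"
  let ?X = "\<lambda>\<omega>. \<lambda>(i, t) \<in> {1..N} \<times> {1..T}. (of_bool (avail i t \<omega>) :: nat)"
  let ?Y = "\<lambda>\<omega>. \<lambda>(k, t) \<in> {1..K} \<times> {1..T}. sense k t \<omega>"
  have f: "?f \<in> measurable (PiM ({1..N} \<times> {1..T}) (\<lambda>_. count_space UNIV)) (count_space UNIV)"
    using i t by (intro measurable_component_singleton) auto
  have h: "?h \<in> measurable (PiM ({1..K} \<times> {1..T}) (\<lambda>_. count_space UNIV)) (count_space UNIV)"
  proof -
    let ?P = "PiM ({1..K} \<times> {1..T}) (\<lambda>_. count_space UNIV) :: (nat \<times> nat \<Rightarrow> nat) measure"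
    have "Measurable.pred ?P (\<lambda>g. g (k, t) \<noteq> i)" if "k \<in> {1..K}" for k
      using that t
      by (intro measurable_compose[OF measurable_component_singleton, where g = "\<lambda>x. x \<noteq> i"]) auto
    then have "Measurable.pred ?P (\<lambda>g. \<forall>k\<in>{1..K}. g (k, t) \<noteq> i)"
      by (intro pred_intros_finite) auto
    then show ?thesis
      by (rule measurable_compose) simp
  qed
  have ind: "indep_var (count_space UNIV) (?f \<circ> ?X) (count_space UNIV) (?h \<circ> ?Y)"
    by (rule indep_var_compose[OF avail_sense_indep f h])
  have "prob ((\<lambda>\<omega>. ((?f \<circ> ?X) \<omega>, (?h \<circ> ?Y) \<omega>)) -` ({1} \<times> {1}) \<inter> space M)
      = prob ((?f \<circ> ?X) -` {1} \<inter> space M) * prob ((?h \<circ> ?Y) -` {1} \<inter> space M)"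
    by (rule indep_varD[OF ind]) auto
  also have "(\<lambda>\<omega>. ((?f \<circ> ?X) \<omega>, (?h \<circ> ?Y) \<omega>)) -` ({1} \<times> {1}) \<inter> space M
      = {\<omega> \<in> space M. avail i t \<omega> \<and> (\<forall>k\<in>{1..K}. sense k t \<omega> \<noteq> i)}"
    using i t by (fastforce simp del: One_nat_def)
  also have "(?f \<circ> ?X) -` {1} \<inter> space M = {\<omega> \<in> space M. avail i t \<omega>}"
    using i t by (auto simp del: One_nat_def)
  also have "(?h \<circ> ?Y) -` {1} \<inter> space M = {\<omega> \<in> space M. \<forall>k\<in>{1..K}. sense k t \<omega> \<noteq> i}"
    using t by (fastforce simp del: One_nat_def)
  finally show ?thesis
    using prob_unsensed[OF i t] avail_prob[OF i t] by simp
qed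

text \<open>
  The event that somebody transmits on channel \<open>i\<close> is the event that \<open>i\<close> is free minus the event
  that \<open>i\<close> is free and unsensed; since at most one user transmits, the left-hand side is its
  probability.
\<close>

lemma sum_prob_tx:
  assumes i: "i \<in> {1..N}" and t: "t \<in> {1..T}"
  shows "(\<Sum>k=1..K. prob {\<omega> \<in> space M. tx k i t \<omega>})
    = \<theta> i - \<theta> i * (1 - sensing_prob N \<theta> i) ^ K"
proof -
  let ?A = "{\<omega> \<in> space M. avail i t \<omega>}"
  let ?U = "{\<omega> \<in> space M. avail i t \<omega> \<and> (\<forall>k\<in>{1..K}. sense k t \<omega> \<noteq> i)}"
  have [measurable]: "Measurable.pred M (avail i t)"
    by (rule avail_measurable[OF i t])
  have [measurable]: "sense k t \<in> measurable M (count_space UNIV)" if "k \<in> {1..K}" for k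
    by (rule sense_measurable[OF that t])
  have A: "?A \<in> events" and U: "?U \<in> events"
    by measurable
  have "(\<Sum>k=1..K. prob {\<omega> \<in> space M. tx k i t \<omega>}) = prob (\<Union>k\<in>{1..K}. {\<omega> \<in> space M. tx k i t \<omega>})"
  proof (rule finite_measure_finite_Union[symmetric])
    show "(\<lambda>k. {\<omega> \<in> space M. tx k i t \<omega>}) ` {1..K} \<subseteq> events"
      using tx_measurable[OF _ i t] by auto
    show "disjoint_family_on (\<lambda>k. {\<omega> \<in> space M. tx k i t \<omega>}) {1..K}"
      unfolding disjoint_family_on_def
    proof (intro ballI impI)
      fix k k' assume k: "k \<in> {1..K}" "k' \<in> {1..K}" "k \<noteq> k'"
      \<comment> \<open>A transmission already forces channel i to be free and sensed, which are the
        premises of \<open>tx_unique\<close>.\<close>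
      have "\<not> (tx k i t \<omega> \<and> tx k' i t \<omega>)" if "\<omega> \<in> space M" for \<omega>
        using tx_unique[OF i t that] tx_only[OF _ i t that] k by blast
      then show "{\<omega> \<in> space M. tx k i t \<omega>} \<inter> {\<omega> \<in> space M. tx k' i t \<omega>} = {}"
        by auto
    qed
  qed simp
  also have "(\<Union>k\<in>{1..K}. {\<omega> \<in> space M. tx k i t \<omega>}) = ?A - ?U"
  proof (intro set_eqI iffI)
    fix \<omega> assume "\<omega> \<in> (\<Union>k\<in>{1..K}. {\<omega> \<in> space M. tx k i t \<omega>})"
    then show "\<omega> \<in> ?A - ?U" using tx_only[OF _ i t] by blast
  next
    fix \<omega> assume "\<omega> \<in> ?A - ?U"
    then show "\<omega> \<in> (\<Union>k\<in>{1..K}. {\<omega> \<in> space M. tx k i t \<omega>})"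
      using tx_unique[OF i t, of \<omega>] by blast
  qed
  also have "prob (?A - ?U) = prob ?A - prob ?U"
    using A U by (intro finite_measure_Diff) auto
  finally show ?thesis
    using avail_prob[OF i t] prob_avail_unsensed[OF i t] by simp
qed

text \<open>Expected throughput falls short of the spectral opportunity by the free-but-unsensed
  probability of each channel in each slot; the remaining terms cancel.\<close>

lemma loss_eq:
  "loss M N K T B \<theta> tx = B * real T * (\<Sum>i=1..N. \<theta> i * (1 - sensing_prob N \<theta> i) ^ K)"
proof -
  let ?E = "\<lambda>k i t. {\<omega> \<in> space M. tx k i t \<omega>}"
  have "(\<integral>\<omega>. (\<Sum>k=1..K. user_bits N T B tx k \<omega>) \<partial>M)
      = (\<integral>\<omega>. (\<Sum>k=1..K. \<Sum>t=1..T. \<Sum>i=1..N. B * indicator (?E k i t) \<omega>) \<partial>M)"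
    unfolding user_bits_def
    by (intro Bochner_Integration.integral_cong refl sum.cong) (auto simp: indicator_def)
  also have "\<dots> = (\<Sum>k=1..K. \<Sum>t=1..T. \<Sum>i=1..N. B * prob (?E k i t))"
  proof -
    have "has_bochner_integral M (\<lambda>\<omega>. B * indicator (?E k i t) \<omega>) (B * prob (?E k i t))"
      if "k \<in> {1..K}" "t \<in> {1..T}" "i \<in> {1..N}" for k t i
      using tx_measurable[OF that(1,3,2)]
      by (intro has_bochner_integral_mult_right has_bochner_integral_real_indicator)
        (auto simp: emeasure_eq_measure)
    then show ?thesis
      by (intro has_bochner_integral_integral_eq has_bochner_integral_sum) auto
  qed
  \<comment> \<open>The sum over users moves innermost, where \<open>sum_prob_tx\<close> evaluates
    it for each slot and channel.\<close>
  also have "\<dots> = (\<Sum>t=1..T. \<Sum>i=1..N. \<Sum>k=1..K. B * prob (?E k i t))"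
    by (subst sum.swap, intro sum.cong refl sum.swap)
  also have "\<dots> = (\<Sum>t=1..T. \<Sum>i=1..N. B * (\<theta> i - \<theta> i * (1 - sensing_prob N \<theta> i) ^ K))"
    by (intro sum.cong refl) (simp only: sum_distrib_left[symmetric] sum_prob_tx)
  also have "\<dots> = B * real T * (\<Sum>i=1..N. \<theta> i)
      - B * real T * (\<Sum>i=1..N. \<theta> i * (1 - sensing_prob N \<theta> i) ^ K)"
    by (simp add: sum_distrib_left[symmetric] sum_subtractf algebra_simps)
  finally show ?thesis
    by (simp add: loss_def)
qed

end

section \<open>Asymptotics in the number of users\<close>

lemma
  assumes "\<exists>i\<in>{1..N}. 0 < \<theta> i"
  shows min_pos_positive: "0 < min_pos N \<theta>"
    and min_pos_le: "\<And>i. i \<in> {1..N} \<Longrightarrow> 0 < \<theta> i \<Longrightarrow> min_pos N \<theta> \<le> \<theta> i"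
    and min_pos_attained: "\<exists>i\<in>{1..N}. \<theta> i = min_pos N \<theta>"
proof -
  let ?S = "{\<theta> i | i. i \<in> {1..N} \<and> 0 < \<theta> i}"
  have fin: "finite ?S" by simp
  \<comment> \<open>Nonemptiness makes \<open>Min\<close> an actual element of the set, hence a
    positive value of some channel.\<close>
  moreover have "?S \<noteq> {}" using assms by blast
  ultimately have "Min ?S \<in> ?S" by (rule Min_in)
  then show "0 < min_pos N \<theta>" "\<exists>i\<in>{1..N}. \<theta> i = min_pos N \<theta>"
    unfolding min_pos_def by auto
  show "min_pos N \<theta> \<le> \<theta> i" if "i \<in> {1..N}" "0 < \<theta> i" for i
    unfolding min_pos_def using that by (intro Min_le fin) blast
qed

context
  fixes N :: nat and \<theta> :: "nat \<Rightarrow> real"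
  assumes nonneg: "\<And>i. i \<in> {1..N} \<Longrightarrow> 0 \<le> \<theta> i"
    and ex_pos: "\<exists>i\<in>{1..N}. 0 < \<theta> i"
begin

lemma sum_theta_pos: "0 < (\<Sum>l=1..N. \<theta> l)"
  using nonneg ex_pos by (auto intro: sum_pos2)

lemma theta_le_sum: "i \<in> {1..N} \<Longrightarrow> \<theta> i \<le> (\<Sum>l=1..N. \<theta> l)"
  using nonneg by (intro member_le_sum) auto

lemma one_minus_sensing_prob:
  "1 - sensing_prob N \<theta> i = ((\<Sum>l=1..N. \<theta> l) - \<theta> i) / (\<Sum>l=1..N. \<theta> l)"
  using sum_theta_pos by (simp add: sensing_prob_def diff_divide_distrib)

text \<open>One channel attains the minimum and a second positive one adds to the sum. This keeps
  the denominator in \<open>decay_exponent\<close> positive.\<close>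

lemma min_pos_less_sum:
  assumes "2 \<le> card {i \<in> {1..N}. 0 < \<theta> i}"
  shows "min_pos N \<theta> < (\<Sum>l=1..N. \<theta> l)"
proof -
  obtain a where a: "a \<in> {1..N}" "\<theta> a = min_pos N \<theta>"
    using min_pos_attained[OF ex_pos] by blast
  have "\<not> {i \<in> {1..N}. 0 < \<theta> i} \<subseteq> {a}"
    using assms card_mono[of "{a}" "{i \<in> {1..N}. 0 < \<theta> i}"] by auto
  then obtain b where b: "b \<in> {1..N}" "0 < \<theta> b" "b \<noteq> a" by blast
  have "\<theta> a + \<theta> b = (\<Sum>l\<in>{a, b}. \<theta> l)"
    using b by simp
  also have "\<dots> \<le> (\<Sum>l=1..N. \<theta> l)"
    using a b nonneg by (intro sum_mono2) auto
  finally show ?thesis using a b by simp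
qed

text \<open>Identifies the normalizing exponential with the geometric sequence of a channel of least
  positive \<theta>, so that the quotient in the limit is again a sum of geometric
  sequences.\<close>

lemma exp_decay_exponent:
  assumes "min_pos N \<theta> < (\<Sum>l=1..N. \<theta> l)"
  shows "exp (- decay_exponent N \<theta> * real K)
    = (((\<Sum>l=1..N. \<theta> l) - min_pos N \<theta>) / (\<Sum>l=1..N. \<theta> l)) ^ K"
proof -
  have "- decay_exponent N \<theta> = ln (((\<Sum>l=1..N. \<theta> l) - min_pos N \<theta>) / (\<Sum>l=1..N. \<theta> l))"
    using assms sum_theta_pos by (simp add: decay_exponent_def ln_div)
  then show ?thesis
    using assms sum_theta_pos by (simp add: exp_of_nat2_mult)
qed

lemma decay_exponent_pos:
  assumes "min_pos N \<theta> < (\<Sum>l=1..N. \<theta> l)"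
  shows "0 < decay_exponent N \<theta>"
  using assms min_pos_positive[OF ex_pos] sum_theta_pos by (simp add: decay_exponent_def)

text \<open>
  Among the channels with positive \<open>\<theta>\<close>, the least \<open>\<theta>\<close> gives the slowest geometric decay; every
  channel attaining it contributes to the limit.
\<close>

lemma normalized_loss_tendsto:
  assumes less: "min_pos N \<theta> < (\<Sum>l=1..N. \<theta> l)"
  shows "(\<lambda>K. (\<Sum>i=1..N. \<theta> i * (1 - sensing_prob N \<theta> i) ^ K) / exp (- decay_exponent N \<theta> * real K))
    \<longlonglongrightarrow> real (card {i \<in> {1..N}. \<theta> i = min_pos N \<theta>}) * min_pos N \<theta>"
proof -
  let ?S = "\<Sum>l=1..N. \<theta> l" and ?m = "min_pos N \<theta>"
  have lim: "(\<lambda>K. \<theta> i * ((?S - \<theta> i) / (?S - ?m)) ^ K) \<longlonglongrightarrow> (if \<theta> i = ?m then ?m else 0)"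
    if i: "i \<in> {1..N}" for i
  proof -
    \<comment> \<open>The summand vanishes, or its ratio is exactly 1, or its ratio lies in [0,
      1).\<close>
    consider "\<theta> i = 0" | "\<theta> i = ?m" | "0 < \<theta> i" "\<theta> i \<noteq> ?m"
      using nonneg[OF i] by fastforce
    then show ?thesis
    proof cases
      case 1
      then show ?thesis using min_pos_positive[OF ex_pos] by simp
    next
      case 2
      then show ?thesis using less by simp
    next
      case 3
      then have "?m < \<theta> i"
        using min_pos_le[OF ex_pos i] by simp
      then have "norm ((?S - \<theta> i) / (?S - ?m)) < 1"
        using less theta_le_sum[OF i] by simp
      then have "(\<lambda>K. \<theta> i * ((?S - \<theta> i) / (?S - ?m)) ^ K) \<longlonglongrightarrow> \<theta> i * 0"
        by (intro tendsto_mult tendsto_const LIMSEQ_power_zero)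
      then show ?thesis using 3 by simp
    qed
  qed
  have "(\<lambda>K. \<Sum>i=1..N. \<theta> i * ((?S - \<theta> i) / (?S - ?m)) ^ K)
      \<longlonglongrightarrow> (\<Sum>i=1..N. if \<theta> i = ?m then ?m else 0)"
    by (intro tendsto_sum lim)
  also have "(\<Sum>i=1..N. if \<theta> i = ?m then ?m else 0) = real (card {i \<in> {1..N}. \<theta> i = ?m}) * ?m"
    by (simp add: sum.If_cases Int_def)
  \<comment> \<open>The common factor \<open>?S ^ K\<close> cancels between the loss term and the
    exponential.\<close>
  also have "(\<lambda>K. \<Sum>i=1..N. \<theta> i * ((?S - \<theta> i) / (?S - ?m)) ^ K)
      = (\<lambda>K. (\<Sum>i=1..N. \<theta> i * (1 - sensing_prob N \<theta> i) ^ K) / exp (- decay_exponent N \<theta> * real K))"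
    using sum_theta_pos
    unfolding exp_decay_exponent[OF less] one_minus_sensing_prob sum_divide_distrib
    by (simp add: power_divide)
  finally show ?thesis .
qed

text \<open>Every channel of positive \<theta> has ratio at most 1 - m/S, where m is the least
  positive \<theta>, hence at most any larger number below 1. The argument also covers a single
  positive channel, where m = S.\<close>

lemma loss_bigo_exp:
  "\<exists>c>0. (\<lambda>K. \<Sum>i=1..N. \<theta> i * (1 - sensing_prob N \<theta> i) ^ K) \<in> O(\<lambda>K. exp (- c * real K))"
proof -
  let ?S = "\<Sum>l=1..N. \<theta> l" and ?m = "min_pos N \<theta>"
  \<comment> \<open>\<open>?m / 2\<close> instead of \<open>?m\<close> keeps \<open>?r\<close> positive when only one channel has positive \<open>\<theta>\<close>\<close>
  let ?r = "(?S - ?m / 2) / ?S"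
  have m: "0 < ?m" "?m \<le> ?S"
    using min_pos_positive[OF ex_pos] min_pos_attained[OF ex_pos] theta_le_sum by metis+
  have r: "0 < ?r" "?r < 1"
    using m sum_theta_pos by auto
  have "\<theta> i * (1 - sensing_prob N \<theta> i) ^ K \<le> \<theta> i * ?r ^ K"
    and "0 \<le> \<theta> i * (1 - sensing_prob N \<theta> i) ^ K" if i: "i \<in> {1..N}" for i K
  proof -
    have q: "0 \<le> 1 - sensing_prob N \<theta> i"
      using theta_le_sum[OF i] sum_theta_pos by (simp add: one_minus_sensing_prob)
    then show "0 \<le> \<theta> i * (1 - sensing_prob N \<theta> i) ^ K"
      using nonneg[OF i] by simp
    show "\<theta> i * (1 - sensing_prob N \<theta> i) ^ K \<le> \<theta> i * ?r ^ K"
    \<comment> \<open>For \<theta> i = 0 the ratio is 1 and exceeds \<open>?r\<close>, but the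
      weight makes both sides 0.\<close>
    proof (cases "\<theta> i = 0")
      case False
      then have "?m \<le> \<theta> i"
        using nonneg[OF i] min_pos_le[OF ex_pos i] by simp
      then have "1 - sensing_prob N \<theta> i \<le> ?r"
        using m sum_theta_pos unfolding one_minus_sensing_prob by (intro divide_right_mono) auto
      then show ?thesis
        using q nonneg[OF i] by (intro mult_left_mono power_mono)
    qed simp
  qed
  then have "0 \<le> (\<Sum>i=1..N. \<theta> i * (1 - sensing_prob N \<theta> i) ^ K)"
    and "(\<Sum>i=1..N. \<theta> i * (1 - sensing_prob N \<theta> i) ^ K) \<le> ?S * ?r ^ K" for K
    unfolding sum_distrib_right by (blast intro: sum_nonneg sum_mono)+
  then have "norm (\<Sum>i=1..N. \<theta> i * (1 - sensing_prob N \<theta> i) ^ K) \<le> ?S * norm (?r ^ K)" for K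
    using r by simp
  then have "(\<lambda>K. \<Sum>i=1..N. \<theta> i * (1 - sensing_prob N \<theta> i) ^ K) \<in> O(\<lambda>K. ?r ^ K)"
    by (intro bigoI[of _ ?S] always_eventually allI)
  also have "(\<lambda>K. ?r ^ K) = (\<lambda>K. exp (- (- ln ?r) * real K))"
  proof
    show "?r ^ K = exp (- (- ln ?r) * real K)" for K
      using r(1) by (simp only: minus_minus mult.commute[of _ "real K"] exp_of_nat_mult exp_ln)
  qed
  finally have "(\<lambda>K. \<Sum>i=1..N. \<theta> i * (1 - sensing_prob N \<theta> i) ^ K) \<in> O(\<lambda>K. exp (- (- ln ?r) * real K))" .
  moreover have "0 < - ln ?r"
    using r ln_less_zero by simp
  ultimately show ?thesis by blast
qed

end

text \<open>The systems for different K may live on unrelated probability spaces: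
  \<open>loss_eq\<close> fixes the loss in terms of K alone. The factor \<open>m\<close> accounts
  for ties at the minimum, and the normalized limit is stated where \<open>c\<^sub>2\<close> is
  finite.\<close>

theorem mainTheorem5:
  fixes N T :: nat and B :: real and \<theta> :: "nat \<Rightarrow> real"
  assumes "\<And>i. i \<in> {1..N} \<Longrightarrow> 0 \<le> \<theta> i \<and> \<theta> i \<le> 1"
    and "\<exists>i\<in>{1..N}. 0 < \<theta> i"
  shows
    "(\<forall>K (M :: 'w measure) avail sense tx.
        proportional_system M N K T \<theta> avail sense tx \<longrightarrow>
          loss M N K T B \<theta> tx =
            B * real T * (\<Sum>i=1..N. \<theta> i * (1 - sensing_prob N \<theta> i) ^ K) \<and>
          loss M N K T B \<theta> tx =
            B * real T * (\<Sum>i=1..N. \<theta> i *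
              (((\<Sum>l=1..N. \<theta> l) - \<theta> i) / (\<Sum>l=1..N. \<theta> l)) ^ K))
     \<and>
     (\<forall>(M :: nat \<Rightarrow> 'w measure) avail sense tx.
        (\<forall>K\<ge>1. proportional_system (M K) N K T \<theta> (avail K) (sense K) (tx K)) \<longrightarrow>
        (let L = (\<lambda>K. loss (M K) N K T B \<theta> (tx K));
             c\<^sub>2 = decay_exponent N \<theta>;
             m = card {i \<in> {1..N}. \<theta> i = min_pos N \<theta>}
         in
          (2 \<le> card {i \<in> {1..N}. 0 < \<theta> i} \<longrightarrow>
             0 < c\<^sub>2 \<and>
             (m = 1 \<longrightarrow>
               (\<lambda>K. L K / exp (- c\<^sub>2 * real K)) \<longlonglongrightarrow> B * real T * min_pos N \<theta>) \<and>
             (\<lambda>K. L K / exp (- c\<^sub>2 * real K)) \<longlonglongrightarrow> real m * (B * real T * min_pos N \<theta>)) \<and>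
          L \<longlonglongrightarrow> 0 \<and>
          (\<exists>c>0. L \<in> O(\<lambda>K. exp (- c * real K)))))"
proof (intro conjI allI impI)
  have nonneg: "\<And>i. i \<in> {1..N} \<Longrightarrow> 0 \<le> \<theta> i"
    using assms(1) by blast
  note props = nonneg assms(2)
  {
    fix K and M :: "'w measure" and avail sense tx
    assume "proportional_system M N K T \<theta> avail sense tx"
    then show "loss M N K T B \<theta> tx =
        B * real T * (\<Sum>i=1..N. \<theta> i * (1 - sensing_prob N \<theta> i) ^ K)"
      by (rule proportional_system.loss_eq)
    then show "loss M N K T B \<theta> tx =
        B * real T * (\<Sum>i=1..N. \<theta> i *
          (((\<Sum>l=1..N. \<theta> l) - \<theta> i) / (\<Sum>l=1..N. \<theta> l)) ^ K)"
      by (simp only: one_minus_sensing_prob[OF props])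
  }
  fix M :: "nat \<Rightarrow> 'w measure" and avail sense tx
  assume sys: "\<forall>K\<ge>1. proportional_system (M K) N K T \<theta> (avail K) (sense K) (tx K)"
  define L where "L = (\<lambda>K. loss (M K) N K T B \<theta> (tx K))"
  define f where "f = (\<lambda>K. \<Sum>i=1..N. \<theta> i * (1 - sensing_prob N \<theta> i) ^ K)"
  define m where "m = card {i \<in> {1..N}. \<theta> i = min_pos N \<theta>}"
  \<comment> \<open>Only an eventual equality: no system is given for K = 0, so \<open>L 0\<close>
    is arbitrary.\<close>
  have L: "eventually (\<lambda>K. L K = B * real T * f K) sequentially"
    unfolding L_def f_def using sys
    by (intro eventually_sequentiallyI[of 1] proportional_system.loss_eq) auto
  have main: "0 < decay_exponent N \<theta>"
    "(\<lambda>K. L K / exp (- decay_exponent N \<theta> * real K)) \<longlonglongrightarrow> real m * (B * real T * min_pos N \<theta>)"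
    if "2 \<le> card {i \<in> {1..N}. 0 < \<theta> i}"
  proof -
    note less = min_pos_less_sum[OF props that]
    show "0 < decay_exponent N \<theta>"
      by (rule decay_exponent_pos[OF props less])
    have "(\<lambda>K. B * real T * (f K / exp (- decay_exponent N \<theta> * real K)))
        \<longlonglongrightarrow> B * real T * (real m * min_pos N \<theta>)"
      unfolding f_def m_def by (intro tendsto_mult tendsto_const normalized_loss_tendsto[OF props less])
    moreover have "eventually (\<lambda>K. B * real T * (f K / exp (- decay_exponent N \<theta> * real K))
        = L K / exp (- decay_exponent N \<theta> * real K)) sequentially"
      using L by eventually_elim simp
    ultimately have "(\<lambda>K. L K / exp (- decay_exponent N \<theta> * real K))
        \<longlonglongrightarrow> B * real T * (real m * min_pos N \<theta>)"
      by (rule Lim_transform_eventually)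
    then show "(\<lambda>K. L K / exp (- decay_exponent N \<theta> * real K))
        \<longlonglongrightarrow> real m * (B * real T * min_pos N \<theta>)"
      by (simp add: algebra_simps)
  qed
  obtain c where c: "0 < c" "f \<in> O(\<lambda>K. exp (- c * real K))"
    using loss_bigo_exp[OF props] unfolding f_def by auto
  have "(\<lambda>K. B * real T * f K) \<in> O(\<lambda>K. exp (- c * real K))"
    \<comment> \<open>A nonzero constant factor drops out of the O-estimate; a zero one leaves the
      zero function.\<close>
    using c(2) by (cases "B * real T = 0") simp_all
  then have bigo: "L \<in> O(\<lambda>K. exp (- c * real K))"
    using landau_o.big.in_cong[OF L] by simp
  have "(\<lambda>K. exp (- c * real K)) \<in> o(\<lambda>_. 1 :: real)"
    using c(1) by real_asymp
  then have "L \<longlonglongrightarrow> 0"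
    using landau_o.big_small_trans[OF bigo] smalloD_tendsto by fastforce
  then show "let L = (\<lambda>K. loss (M K) N K T B \<theta> (tx K));
             c\<^sub>2 = decay_exponent N \<theta>;
             m = card {i \<in> {1..N}. \<theta> i = min_pos N \<theta>}
         in
          (2 \<le> card {i \<in> {1..N}. 0 < \<theta> i} \<longrightarrow>
             0 < c\<^sub>2 \<and>
             (m = 1 \<longrightarrow>
               (\<lambda>K. L K / exp (- c\<^sub>2 * real K)) \<longlonglongrightarrow> B * real T * min_pos N \<theta>) \<and>
             (\<lambda>K. L K / exp (- c\<^sub>2 * real K)) \<longlonglongrightarrow> real m * (B * real T * min_pos N \<theta>)) \<and>
          L \<longlonglongrightarrow> 0 \<and>
          (\<exists>c>0. L \<in> O(\<lambda>K. exp (- c * real K)))"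
    unfolding Let_def L_def[symmetric] m_def[symmetric]
    using main bigo c(1) by auto
qed

end
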